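(* Let $\Delta$ be a guarded recursive specification over TSP with sequencing and non-acceptance. For every process expression $p$ there exist a natural number $n$, actions $a_1,\dots,a_n\in\mathit{Act}\cup\{\tau\}$ and process expressions $p_1,\dots,p_n$ such that either the equation $p=\sum_{i=1}^n a_i.p_i$ or the equation $p = 1+\sum_{i=1}^n a_i.p_i$ is derivable in equational logic from the axioms A1–A3, A5–A13, NA1–NA4 together with the equations $X=\Delta(X)$ ($X\in\mathcal{P}$).
   Context: Fix a set $\mathit{Act}$ of actions, $\tau\notin\mathit{Act}$, and a finite set $\mathcal{P}$ of process identifiers. Process expressions are generated by $p ::= 0 \mid 1 \mid a.p \mid p+p \mid p; p \mid \mathit{NA}(p) \mid X$ with $a\in\mathit{Act}\cup\{\tau\}$, $X\in\mathcal{P}$ ($;$ is the sequencing operator, $\mathit{NA}$ the non-acceptance operator). A recursive specification $\Delta$ assigns to every $X\in\mathcal{P}$ an expression $\Delta(X)$; it is guarded if every occurrence of a process identifier in each right-hand side lies within the scope of an action prefix $a.\_$. For a sequence $p_1,\dots,p_n$, $\sum_{i=1}^n p_i$ is $0$ if $n=0$ and $(\sum_{i=1}^{n-1}p_i)+p_n$ if $n>0$. Axioms (with $x,y,z$ variables and $a\in\mathit{Act}\cup\{\tau\}$): A1 $x+y=y+x$; A2 $x+(y+z)=(x+y)+z$; A3 $x+x=x$; A5 $(x;y);z=x;(y;z)$; A6 $x+0=x$; A7 $0;x=0$; A8 $x;1=x$; A9 $1;x=x$; A10 $(a.x);y=a.(x;y)$; NA1 $\mathit{NA}(0)=0$; NA2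 $\mathit{NA}(1)=0$; NA3 $\mathit{NA}(a.x)=a.x$; NA4 $\mathit{NA}(x+y)=\mathit{NA}(x)+\mathit{NA}(y)$; A11 $\mathit{NA}(x+y);z=\mathit{NA}(x);z+\mathit{NA}(y);z$; A12 $(a.x+y+1);\mathit{NA}(z)=(a.x+y);\mathit{NA}(z)$; A13 $(a.x+y+1);(z+1)=(a.x+y);(z+1)+1$. *)

theory Defs
  imports Main
begin

text \<open>
  Open terms over the signature. The constructor \<open>Var\<close> gives the variables used to state the
  axioms; process expressions are the terms without variables. \<open>Ident X\<close> is the process identifier \<open>X\<close>.
\<close>

datatype ('a, 'x) pterm =
    Var nat
  | Zero
  | One
  | Pre 'a "('a, 'x) pterm"                  (infixr "\<cdot>" 80)
  | Alt "('a, 'x) pterm" "('a, 'x) pterm"    (infixl "\<oplus>" 65)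
  | Seq "('a, 'x) pterm" "('a, 'x) pterm"    (infixl ";;" 70)
  | NA "('a, 'x) pterm"
  | Ident 'x

text \<open>
  Below, \<open>L\<close> stands for the set of labels, that is, the set of actions together with the silent
  step, and \<open>P\<close> for the set of process identifiers. Both are sets rather than types so that they
  may be \<open>{\<tau>}\<close> and empty, respectively.
\<close>

inductive_set pterms :: "'a set \<Rightarrow> 'x set \<Rightarrow> ('a, 'x) pterm set"
  for L :: "'a set" and P :: "'x set" where
  "Var v \<in> pterms L P"
| "Zero \<in> pterms L P"
| "One \<in> pterms L P"
| "a \<in> L \<Longrightarrow> p \<in> pterms L P \<Longrightarrow> a \<cdot> p \<in> pterms L P"
| "p \<in> pterms L P \<Longrightarrow> q \<in> pterms L P \<Longrightarrow> p \<oplus> q \<in> pterms L P"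
| "p \<in> pterms L P \<Longrightarrow> q \<in> pterms L P \<Longrightarrow> p ;; q \<in> pterms L P"
| "p \<in> pterms L P \<Longrightarrow> NA p \<in> pterms L P"
| "X \<in> P \<Longrightarrow> Ident X \<in> pterms L P"

inductive_set pexprs :: "'a set \<Rightarrow> 'x set \<Rightarrow> ('a, 'x) pterm set"
  for L :: "'a set" and P :: "'x set" where
  "Zero \<in> pexprs L P"
| "One \<in> pexprs L P"
| "a \<in> L \<Longrightarrow> p \<in> pexprs L P \<Longrightarrow> a \<cdot> p \<in> pexprs L P"
| "p \<in> pexprs L P \<Longrightarrow> q \<in> pexprs L P \<Longrightarrow> p \<oplus> q \<in> pexprs L P"
| "p \<in> pexprs L P \<Longrightarrow> q \<in> pexprs L P \<Longrightarrow> p ;; q \<in> pexprs L P"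
| "p \<in> pexprs L P \<Longrightarrow> NA p \<in> pexprs L P"
| "X \<in> P \<Longrightarrow> Ident X \<in> pexprs L P"

definition rec_spec :: "'a set \<Rightarrow> 'x set \<Rightarrow> ('x \<Rightarrow> ('a, 'x) pterm) \<Rightarrow> bool" where
  "rec_spec L P \<Delta> \<longleftrightarrow> (\<forall>X\<in>P. \<Delta> X \<in> pexprs L P)"

primrec guarded_term :: "('a, 'x) pterm \<Rightarrow> bool" where
  "guarded_term (Var v) \<longleftrightarrow> True"
| "guarded_term Zero \<longleftrightarrow> True"
| "guarded_term One \<longleftrightarrow> True"
| "guarded_term (a \<cdot> p) \<longleftrightarrow> True"
| "guarded_term (p \<oplus> q) \<longleftrightarrow> guarded_term p \<and> guarded_term q"
| "guarded_term (p ;; q) \<longleftrightarrow> guarded_term p \<and> guarded_term q"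
| "guarded_term (NA p) \<longleftrightarrow> guarded_term p"
| "guarded_term (Ident X) \<longleftrightarrow> False"

definition guarded :: "'x set \<Rightarrow> ('x \<Rightarrow> ('a, 'x) pterm) \<Rightarrow> bool" where
  "guarded P \<Delta> \<longleftrightarrow> (\<forall>X\<in>P. guarded_term (\<Delta> X))"

text \<open>\<open>psum p n\<close> is the sum of \<open>p 1, \<dots>, p n\<close>, in this order and associated to the left.\<close>

primrec psum :: "(nat \<Rightarrow> ('a, 'x) pterm) \<Rightarrow> nat \<Rightarrow> ('a, 'x) pterm" where
  "psum p 0 = Zero"
| "psum p (Suc n) = psum p n \<oplus> p (Suc n)"

abbreviation (input) "vx \<equiv> Var 0"
abbreviation (input) "vy \<equiv> Var 1"
abbreviation (input) "vz \<equiv> Var 2"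

inductive_set tsp_axioms :: "'a set \<Rightarrow> (('a, 'x) pterm \<times> ('a, 'x) pterm) set"
  for L :: "'a set" where
  A1: "(vx \<oplus> vy, vy \<oplus> vx) \<in> tsp_axioms L"
| A2: "(vx \<oplus> (vy \<oplus> vz), (vx \<oplus> vy) \<oplus> vz) \<in> tsp_axioms L"
| A3: "(vx \<oplus> vx, vx) \<in> tsp_axioms L"
| A5: "((vx ;; vy) ;; vz, vx ;; (vy ;; vz)) \<in> tsp_axioms L"
| A6: "(vx \<oplus> Zero, vx) \<in> tsp_axioms L"
| A7: "(Zero ;; vx, Zero) \<in> tsp_axioms L"
| A8: "(vx ;; One, vx) \<in> tsp_axioms L"
| A9: "(One ;; vx, vx) \<in> tsp_axioms L"
| A10: "a \<in> L \<Longrightarrow> ((a \<cdot> vx) ;; vy, a \<cdot> (vx ;; vy)) \<in> tsp_axioms L"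
| A11: "(NA (vx \<oplus> vy) ;; vz, (NA vx ;; vz) \<oplus> (NA vy ;; vz)) \<in> tsp_axioms L"
| A12: "a \<in> L \<Longrightarrow>
    (((a \<cdot> vx) \<oplus> vy \<oplus> One) ;; NA vz, ((a \<cdot> vx) \<oplus> vy) ;; NA vz) \<in> tsp_axioms L"
| A13: "a \<in> L \<Longrightarrow>
    (((a \<cdot> vx) \<oplus> vy \<oplus> One) ;; (vz \<oplus> One), (((a \<cdot> vx) \<oplus> vy) ;; (vz \<oplus> One)) \<oplus> One)
      \<in> tsp_axioms L"
| NA1: "(NA Zero, Zero) \<in> tsp_axioms L"
| NA2: "(NA One, Zero) \<in> tsp_axioms L"
| NA3: "a \<in> L \<Longrightarrow> (NA (a \<cdot> vx), a \<cdot> vx) \<in> tsp_axioms L"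
| NA4: "(NA (vx \<oplus> vy), NA vx \<oplus> NA vy) \<in> tsp_axioms L"

definition spec_equations ::
  "'x set \<Rightarrow> ('x \<Rightarrow> ('a, 'x) pterm) \<Rightarrow> (('a, 'x) pterm \<times> ('a, 'x) pterm) set" where
  "spec_equations P \<Delta> = {(Ident X, \<Delta> X) | X. X \<in> P}"

primrec psubst :: "(nat \<Rightarrow> ('a, 'x) pterm) \<Rightarrow> ('a, 'x) pterm \<Rightarrow> ('a, 'x) pterm" where
  "psubst \<sigma> (Var v) = \<sigma> v"
| "psubst \<sigma> Zero = Zero"
| "psubst \<sigma> One = One"
| "psubst \<sigma> (a \<cdot> p) = a \<cdot> psubst \<sigma> p"
| "psubst \<sigma> (p \<oplus> q) = psubst \<sigma> p \<oplus> psubst \<sigma> q"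
| "psubst \<sigma> (p ;; q) = psubst \<sigma> p ;; psubst \<sigma> q"
| "psubst \<sigma> (NA p) = NA (psubst \<sigma> p)"
| "psubst \<sigma> (Ident X) = Ident X"

text \<open>
  Derivability of an equation from the equations \<open>E\<close> in equational logic over the signature given
  by \<open>L\<close> and \<open>P\<close>. Process identifiers are constants of the signature, hence fixed by substitutions.
\<close>

inductive eq_derivable ::
  "'a set \<Rightarrow> 'x set \<Rightarrow> (('a, 'x) pterm \<times> ('a, 'x) pterm) set \<Rightarrow>
   ('a, 'x) pterm \<Rightarrow> ('a, 'x) pterm \<Rightarrow> bool"
  for L :: "'a set" and P :: "'x set" and E :: "(('a, 'x) pterm \<times> ('a, 'x) pterm) set" where
  ax: "(s, t) \<in> E \<Longrightarrow> eq_derivable L P E s t"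
| refl: "t \<in> pterms L P \<Longrightarrow> eq_derivable L P E t t"
| sym: "eq_derivable L P E s t \<Longrightarrow> eq_derivable L P E t s"
| trans: "eq_derivable L P E s t \<Longrightarrow> eq_derivable L P E t u \<Longrightarrow> eq_derivable L P E s u"
| subst: "eq_derivable L P E s t \<Longrightarrow> (\<And>v. \<sigma> v \<in> pterms L P) \<Longrightarrow>
    eq_derivable L P E (psubst \<sigma> s) (psubst \<sigma> t)"
| cong_Pre: "a \<in> L \<Longrightarrow> eq_derivable L P E s t \<Longrightarrow> eq_derivable L P E (a \<cdot> s) (a \<cdot> t)"
| cong_Alt: "eq_derivable L P E s t \<Longrightarrow> eq_derivable L P E s' t' \<Longrightarrow>
    eq_derivable L P E (s \<oplus> s') (t \<oplus> t')"
| cong_Seq: "eq_derivable L P E s t \<Longrightarrow> eq_derivable L P E s' t' \<Longrightarrow>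
    eq_derivable L P E (s ;; s') (t ;; t')"
| cong_NA: "eq_derivable L P E s t \<Longrightarrow> eq_derivable L P E (NA s) (NA t)"

end

theory Submission
  imports Defs
begin

text \<open>
  Sums of action prefixes \<open>s\<close> satisfy \<open>s = NA(s)\<close>, so A11 provides the right distributivity that
  sequencing lacks in general and turns \<open>s ; q\<close> into a sum of action prefixes. A process \<open>1 + s\<close>
  followed by \<open>q\<close> is \<open>q\<close> if \<open>s\<close> is empty; otherwise A12 or A13 applies, according to whether the
  head normal form of \<open>q\<close> lacks or has the summand \<open>1\<close>. Hence head normal forms are closed under
  all operators. This settles all guarded expressions, then all identifiers through \<open>X = \<Delta>(X)\<close>,
  and then all expressions.
\<close>

section \<open>Sums of action prefixes\<close>

inductive_set prefix_sums :: "'a set \<Rightarrow> 'x set \<Rightarrow> ('a, 'x) pterm set"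
  for L :: "'a set" and P :: "'x set" where
  Zero: "Zero \<in> prefix_sums L P"
| Alt: "s \<in> prefix_sums L P \<Longrightarrow> a \<in> L \<Longrightarrow> p \<in> pexprs L P \<Longrightarrow> s \<oplus> a \<cdot> p \<in> prefix_sums L P"

lemma pexprs_imp_pterms: "p \<in> pexprs L P \<Longrightarrow> p \<in> pterms L P"
  by (induction rule: pexprs.induct) (auto intro: pterms.intros)

lemma prefix_sums_imp_pterms: "s \<in> prefix_sums L P \<Longrightarrow> s \<in> pterms L P"
  by (induction rule: prefix_sums.induct) (auto intro: pterms.intros pexprs_imp_pterms)

lemma psum_cong: "(\<And>i. i \<in> {1..n} \<Longrightarrow> f i = g i) \<Longrightarrow> psum f n = psum g n"
  by (induction n) auto

lemma prefix_sums_imp_psum: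
  assumes "s \<in> prefix_sums L P"
  shows "\<exists>n a q. (\<forall>i\<in>{1..n}. a i \<in> L \<and> q i \<in> pexprs L P) \<and> s = psum (\<lambda>i. a i \<cdot> q i) n"
  using assms
proof induction
  case Zero
  \<comment> \<open>For \<open>n = 0\<close> the index range is empty, so any \<open>a\<close> and
    \<open>q\<close> serve as witnesses.\<close>
  have "Zero = psum (\<lambda>i. a i \<cdot> q i) 0" for a :: "nat \<Rightarrow> 'a" and q :: "nat \<Rightarrow> ('a, 'b) pterm"
    by simp
  then show ?case by fastforce
next
  case (Alt s b p)
  then obtain n a q where aq: "\<forall>i\<in>{1..n}. a i \<in> L \<and> q i \<in> pexprs L P"
    and s: "s = psum (\<lambda>i. a i \<cdot> q i) n"
    by blast
  \<comment> \<open>The update at \<open>Suc n\<close> lies outside the old range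
    \<open>{1..n}\<close>, so the old sum is unchanged.\<close>
  let ?a = "a(Suc n := b)" and ?q = "q(Suc n := p)"
  have "s = psum (\<lambda>i. ?a i \<cdot> ?q i) n"
    unfolding s by (rule psum_cong) auto
  then have "s \<oplus> b \<cdot> p = psum (\<lambda>i. ?a i \<cdot> ?q i) (Suc n)"
    by simp
  moreover have "\<forall>i\<in>{1..Suc n}. ?a i \<in> L \<and> ?q i \<in> pexprs L P"
    using aq Alt.hyps by (auto simp: le_Suc_eq)
  ultimately show ?case by blast
qed

section \<open>Instances of the axioms in an arbitrary extension of the theory\<close>

locale tsp_theory =
  fixes L :: "'a set" and P :: "'x set" and E :: "(('a, 'x) pterm \<times> ('a, 'x) pterm) set"
  assumes axioms_subset: "tsp_axioms L \<subseteq> E"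
begin

abbreviation derivable (infix "\<approx>" 50) where
  "s \<approx> t \<equiv> eq_derivable L P E s t"

abbreviation "T \<equiv> pterms L P"

declare eq_derivable.trans [trans]

text \<open>The axioms use the variables 0, 1 and 2 only. All remaining variables also go to
  \<open>z\<close>, because a substitution must map every variable into \<open>T\<close>.\<close>

lemma axiom_instance:
  assumes "(s, t) \<in> tsp_axioms L" and "x \<in> T" "y \<in> T" "z \<in> T"
  defines "\<sigma> \<equiv> \<lambda>v :: nat. if v = 0 then x else if v = 1 then y else z"
  shows "psubst \<sigma> s \<approx> psubst \<sigma> t"
proof (rule eq_derivable.subst)
  show "s \<approx> t"
    using assms(1) axioms_subset by (blast intro: eq_derivable.ax)
  show "\<sigma> v \<in> T" for v
    using assms by simp
qed

text \<open>All instances share the parameters \<open>x\<close>, \<open>y\<close>, \<open>z\<close>;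
  where an equation omits some of them, later uses fill these with a dummy such as
  \<open>One\<close>.\<close>

lemma
  assumes "x \<in> T" "y \<in> T" "z \<in> T"
  shows Alt_commute: "x \<oplus> y \<approx> y \<oplus> x"
    and Alt_assoc: "x \<oplus> y \<oplus> z \<approx> x \<oplus> (y \<oplus> z)"
    and Alt_idem: "x \<oplus> x \<approx> x"
    and Alt_Zero: "x \<oplus> Zero \<approx> x"
    and Zero_Seq: "Zero ;; x \<approx> Zero"
    and One_Seq: "One ;; x \<approx> x"
    and Pre_Seq: "a \<in> L \<Longrightarrow> (a \<cdot> x) ;; y \<approx> a \<cdot> (x ;; y)"
    and NA_Alt_Seq: "NA (x \<oplus> y) ;; z \<approx> NA x ;; z \<oplus> NA y ;; z"
    and Alt_One_Seq_NA: "a \<in> L \<Longrightarrow> (a \<cdot> x \<oplus> y \<oplus> One) ;; NA z \<approx> (a \<cdot> x \<oplus> y) ;; NA z"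
    and Alt_One_Seq_Alt_One:
      "a \<in> L \<Longrightarrow> (a \<cdot> x \<oplus> y \<oplus> One) ;; (z \<oplus> One) \<approx> (a \<cdot> x \<oplus> y) ;; (z \<oplus> One) \<oplus> One"
    and NA_Zero: "NA Zero \<approx> Zero"
    and NA_One: "NA One \<approx> Zero"
    and NA_Pre: "a \<in> L \<Longrightarrow> NA (a \<cdot> x) \<approx> a \<cdot> x"
    and NA_Alt: "NA (x \<oplus> y) \<approx> NA x \<oplus> NA y"
  using axiom_instance[OF A1 assms] axiom_instance[OF A2 assms, THEN eq_derivable.sym]
    axiom_instance[OF A3 assms] axiom_instance[OF A6 assms] axiom_instance[OF A7 assms]
    axiom_instance[OF A9 assms] axiom_instance[OF A10 assms] axiom_instance[OF A11 assms]
    axiom_instance[OF A12 assms] axiom_instance[OF A13 assms] axiom_instance[OF NA1 assms]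
    axiom_instance[OF NA2 assms] axiom_instance[OF NA3 assms] axiom_instance[OF NA4 assms]
  by simp_all

declare pterms.intros [simp] pexprs_imp_pterms [simp] prefix_sums_imp_pterms [simp]

lemmas cong_intros = eq_derivable.cong_Alt eq_derivable.cong_Seq eq_derivable.refl

lemma Zero_Alt: "x \<in> T \<Longrightarrow> Zero \<oplus> x \<approx> x"
  by (rule eq_derivable.trans[OF Alt_commute[of _ _ One] Alt_Zero[of _ One One]]) simp_all

section \<open>Prefix sums under non-acceptance, choice and sequencing\<close>

lemma prefix_sums_NA: "s \<in> prefix_sums L P \<Longrightarrow> NA s \<approx> s"
proof (induction rule: prefix_sums.induct)
  case Zero
  show ?case by (rule NA_Zero[of One One One]) simp_all
next
  case (Alt s a p)
  have "NA (s \<oplus> a \<cdot> p) \<approx> NA s \<oplus> NA (a \<cdot> p)"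
    using Alt.hyps by (intro NA_Alt[of _ _ One]) simp_all
  also have "\<dots> \<approx> s \<oplus> a \<cdot> p"
    using Alt by (intro eq_derivable.cong_Alt NA_Pre[of _ One One]) simp_all
  finally show ?case .
qed

lemma prefix_sums_Alt:
  assumes "s \<in> prefix_sums L P" "t \<in> prefix_sums L P"
  shows "\<exists>u \<in> prefix_sums L P. s \<oplus> t \<approx> u"
  using assms(2)
proof induction
  case Zero
  show ?case
    using assms(1) Alt_Zero[of s s s] prefix_sums_imp_pterms by blast
next
  case (Alt t a p)
  then obtain u where u: "u \<in> prefix_sums L P" "s \<oplus> t \<approx> u" by blast
  have "s \<oplus> (t \<oplus> a \<cdot> p) \<approx> s \<oplus> t \<oplus> a \<cdot> p"
    using Alt.hyps assms(1) by (intro eq_derivable.sym[OF Alt_assoc]) simp_all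
  also have "\<dots> \<approx> u \<oplus> a \<cdot> p"
    using u Alt.hyps by (intro cong_intros) simp_all
  finally show ?case
    using u Alt.hyps by (intro bexI[of _ "u \<oplus> a \<cdot> p"] prefix_sums.Alt)
qed

text \<open>Summands \<open>a \<cdot> p\<close> become \<open>a \<cdot> (p ;; q)\<close> by A10. The
  new continuation must again be a process expression, whence the condition on
  \<open>q\<close>.\<close>

lemma prefix_sums_Seq:
  assumes "s \<in> prefix_sums L P" and q: "q \<in> pexprs L P"
  shows "\<exists>u \<in> prefix_sums L P. s ;; q \<approx> u"
  using assms(1)
proof induction
  case Zero
  show ?case
    using Zero_Seq[of q q q] q pexprs_imp_pterms prefix_sums.Zero by blast
next
  case (Alt s a p)
  then obtain u where u: "u \<in> prefix_sums L P" "s ;; q \<approx> u" by blast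
  have T: "s \<in> T" "a \<cdot> p \<in> T" "p \<in> T" "q \<in> T"
    using Alt.hyps q by auto
  \<comment> \<open>\<open>NA\<close> is inserted only to make A11 applicable; it is removed again
    from each summand afterwards.\<close>
  have "(s \<oplus> a \<cdot> p) ;; q \<approx> NA (s \<oplus> a \<cdot> p) ;; q"
    using T Alt.hyps
    by (intro eq_derivable.cong_Seq eq_derivable.refl eq_derivable.sym[OF prefix_sums_NA]
        prefix_sums.Alt) simp_all
  also have "\<dots> \<approx> NA s ;; q \<oplus> NA (a \<cdot> p) ;; q"
    using T by (intro NA_Alt_Seq)
  also have "\<dots> \<approx> s ;; q \<oplus> (a \<cdot> p) ;; q"
    using T Alt.hyps
    by (intro eq_derivable.cong_Alt eq_derivable.cong_Seq eq_derivable.refl prefix_sums_NA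
        NA_Pre[of _ One One]) simp_all
  also have "\<dots> \<approx> u \<oplus> a \<cdot> (p ;; q)"
    using T u Alt.hyps by (intro eq_derivable.cong_Alt Pre_Seq[of _ _ One]) simp_all
  finally show ?case
    using u q Alt.hyps
    by (intro bexI[of _ "u \<oplus> a \<cdot> (p ;; q)"] prefix_sums.Alt pexprs.intros)
qed

section \<open>Closure of head normal forms under the operators\<close>

definition has_hnf :: "('a, 'x) pterm \<Rightarrow> bool" where
  "has_hnf p \<longleftrightarrow> (\<exists>u \<in> prefix_sums L P. p \<approx> u \<or> p \<approx> One \<oplus> u)"

lemma has_hnf_cong: "p \<approx> q \<Longrightarrow> has_hnf q \<Longrightarrow> has_hnf p"
  unfolding has_hnf_def by (blast intro: eq_derivable.trans)

lemma has_hnf_prefix_sum: "u \<in> prefix_sums L P \<Longrightarrow> has_hnf u"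
  unfolding has_hnf_def by (blast intro: eq_derivable.refl prefix_sums_imp_pterms)

lemma has_hnf_One_Alt_prefix_sum: "u \<in> prefix_sums L P \<Longrightarrow> has_hnf (One \<oplus> u)"
  unfolding has_hnf_def by (blast intro: eq_derivable.refl prefix_sums_imp_pterms pterms.intros)

lemma has_hnf_One: "has_hnf One"
proof -
  have "One \<approx> One \<oplus> Zero"
    by (intro eq_derivable.sym[OF Alt_Zero[of _ One One]]) simp_all
  then show ?thesis
    using prefix_sums.Zero unfolding has_hnf_def by blast
qed

text \<open>Only the head is normalised, so nothing is asked of \<open>p\<close> beyond being a
  process expression. The leading \<open>Zero\<close> is there because every prefix sum starts with
  it.\<close>

lemma has_hnf_Pre:
  assumes "a \<in> L" "p \<in> pexprs L P"
  shows "has_hnf (a \<cdot> p)"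
proof (rule has_hnf_cong)
  show "a \<cdot> p \<approx> Zero \<oplus> a \<cdot> p"
    using assms by (intro eq_derivable.sym[OF Zero_Alt]) simp_all
  show "has_hnf (Zero \<oplus> a \<cdot> p)"
    using assms by (intro has_hnf_prefix_sum prefix_sums.intros)
qed

text \<open>A summand \<open>One\<close> already present in the normal form of \<open>p\<close> is
  absorbed by idempotence.\<close>

lemma has_hnf_One_Alt:
  assumes "has_hnf p"
  shows "has_hnf (One \<oplus> p)"
proof -
  obtain u where u: "u \<in> prefix_sums L P" and p: "p \<approx> u \<or> p \<approx> One \<oplus> u"
    using assms unfolding has_hnf_def by blast
  from p have "One \<oplus> p \<approx> One \<oplus> u"
  proof
    assume "p \<approx> One \<oplus> u"
    then have "One \<oplus> p \<approx> One \<oplus> (One \<oplus> u)"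
      by (intro cong_intros) simp_all
    also have "\<dots> \<approx> One \<oplus> One \<oplus> u"
      using u by (intro eq_derivable.sym[OF Alt_assoc]) simp_all
    also have "\<dots> \<approx> One \<oplus> u"
      using u by (intro eq_derivable.cong_Alt[OF Alt_idem[of _ One One]] eq_derivable.refl) simp_all
    finally show ?thesis .
  qed (intro cong_intros, simp_all)
  then show ?thesis
    using u unfolding has_hnf_def by blast
qed

lemma has_hnf_Alt_prefix_sum:
  assumes "has_hnf p" and v: "v \<in> prefix_sums L P"
  shows "has_hnf (p \<oplus> v)"
proof -
  obtain u where u: "u \<in> prefix_sums L P" and p: "p \<approx> u \<or> p \<approx> One \<oplus> u"
    using assms unfolding has_hnf_def by blast
  obtain w where w: "w \<in> prefix_sums L P" "u \<oplus> v \<approx> w"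
    using prefix_sums_Alt[OF u v] by blast
  from p show ?thesis
  proof
    assume "p \<approx> u"
    then have "p \<oplus> v \<approx> u \<oplus> v"
      using v by (intro cong_intros) simp_all
    also note w(2)
    finally show ?thesis
      by (rule has_hnf_cong) (rule has_hnf_prefix_sum[OF w(1)])
  next
    assume "p \<approx> One \<oplus> u"
    then have "p \<oplus> v \<approx> One \<oplus> u \<oplus> v"
      using v by (intro cong_intros) simp_all
    also have "\<dots> \<approx> One \<oplus> (u \<oplus> v)"
      using u v by (intro Alt_assoc) simp_all
    also have "\<dots> \<approx> One \<oplus> w"
      using w by (intro cong_intros) simp_all
    finally show ?thesis
      by (rule has_hnf_cong) (rule has_hnf_One_Alt_prefix_sum[OF w(1)])
  qed
qed

text \<open>Only \<open>q\<close> is replaced by its normal form; a summand \<open>One\<close> of it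
  is moved in front of \<open>p\<close>, which reduces the claim to the two preceding lemmas.
  Keeping \<open>p\<close> in place uses reflexivity, hence \<open>p \<in> T\<close>.\<close>

lemma has_hnf_Alt:
  assumes "p \<in> T" "has_hnf p" "has_hnf q"
  shows "has_hnf (p \<oplus> q)"
proof -
  obtain v where v: "v \<in> prefix_sums L P" and q: "q \<approx> v \<or> q \<approx> One \<oplus> v"
    using assms unfolding has_hnf_def by blast
  from q show ?thesis
  proof
    assume "q \<approx> v"
    then have "p \<oplus> q \<approx> p \<oplus> v"
      using assms by (intro cong_intros) simp_all
    then show ?thesis
      by (rule has_hnf_cong) (rule has_hnf_Alt_prefix_sum[OF assms(2) v])
  next
    assume "q \<approx> One \<oplus> v"
    then have "p \<oplus> q \<approx> p \<oplus> (One \<oplus> v)"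
      using assms by (intro cong_intros) simp_all
    also have "\<dots> \<approx> p \<oplus> One \<oplus> v"
      using assms v by (intro eq_derivable.sym[OF Alt_assoc]) simp_all
    also have "\<dots> \<approx> One \<oplus> p \<oplus> v"
      using assms v by (intro eq_derivable.cong_Alt[OF Alt_commute[of _ _ One]] eq_derivable.refl) simp_all
    finally show ?thesis
      by (rule has_hnf_cong) (rule has_hnf_Alt_prefix_sum[OF has_hnf_One_Alt[OF assms(2)] v])
  qed
qed

text \<open>\<open>NA\<close> deletes the summand \<open>One\<close> and fixes the prefix sum, so
  both forms of \<open>p\<close> yield the same \<open>u\<close>.\<close>

lemma has_hnf_NA:
  assumes "has_hnf p"
  shows "has_hnf (NA p)"
proof -
  obtain u where u: "u \<in> prefix_sums L P" and p: "p \<approx> u \<or> p \<approx> One \<oplus> u"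
    using assms unfolding has_hnf_def by blast
  from p have "NA p \<approx> u"
  proof
    assume "p \<approx> u"
    then have "NA p \<approx> NA u"
      by (rule eq_derivable.cong_NA)
    also have "\<dots> \<approx> u"
      using u by (rule prefix_sums_NA)
    finally show ?thesis .
  next
    assume "p \<approx> One \<oplus> u"
    then have "NA p \<approx> NA (One \<oplus> u)"
      by (rule eq_derivable.cong_NA)
    also have "\<dots> \<approx> NA One \<oplus> NA u"
      using u by (intro NA_Alt[of _ _ One]) simp_all
    also have "\<dots> \<approx> Zero \<oplus> u"
      using u by (intro eq_derivable.cong_Alt NA_One[of One One One] prefix_sums_NA) simp_all
    also have "\<dots> \<approx> u"
      using u by (intro Zero_Alt) simp_all
    finally show ?thesis .
  qed
  then show ?thesis
    using u unfolding has_hnf_def by blast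
qed

lemma has_hnf_One_Alt_prefix_sum_Seq:
  assumes s: "s \<in> prefix_sums L P" and q: "q \<in> pexprs L P" "has_hnf q"
  shows "has_hnf ((One \<oplus> s) ;; q)"
  using s
proof cases
  case Zero
  have "(One \<oplus> Zero) ;; q \<approx> One ;; q"
    using q by (intro eq_derivable.cong_Seq[OF Alt_Zero[of _ One One]] eq_derivable.refl) simp_all
  also have "\<dots> \<approx> q"
    using q by (intro One_Seq[of _ One One]) simp_all
  finally show ?thesis
    using Zero q has_hnf_cong by blast
next
  case (Alt t a p)
  \<comment> \<open>A12 and A13 expect a prefix as first summand and \<open>One\<close> as last. The
    last prefix of \<open>s\<close> is therefore moved to the front, and \<open>t\<close>, possibly
    \<open>Zero\<close>, instantiates their variable \<open>y\<close>.\<close>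
  let ?s = "a \<cdot> p \<oplus> t"
  have T: "t \<in> T" "p \<in> T" "q \<in> T" "s \<in> T" "?s \<in> T"
    using Alt s q by auto
  obtain w where w: "w \<in> prefix_sums L P" "s ;; q \<approx> w"
    using prefix_sums_Seq[OF s q(1)] by blast
  have comm: "?s \<approx> s"
    unfolding Alt using T Alt by (intro Alt_commute[of _ _ One]) simp_all
  have "One \<oplus> s \<approx> s \<oplus> One"
    using T by (intro Alt_commute[of _ _ One]) simp_all
  also have "\<dots> \<approx> ?s \<oplus> One"
    using eq_derivable.sym[OF comm] by (intro cong_intros) simp_all
  finally have one: "One \<oplus> s \<approx> ?s \<oplus> One" .
  obtain v where v: "v \<in> prefix_sums L P" and "q \<approx> v \<or> q \<approx> One \<oplus> v"
    using q unfolding has_hnf_def by blast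
  then consider "q \<approx> v" | "q \<approx> One \<oplus> v" by blast
  then show ?thesis
  proof cases
    case 1
    \<comment> \<open>Without a summand \<open>One\<close>, \<open>q\<close> can be put in the form
      \<open>NA v\<close> that A12 requires on the right.\<close>
    also have "v \<approx> NA v"
      using v by (intro eq_derivable.sym[OF prefix_sums_NA])
    finally have NA: "q \<approx> NA v" .
    have "(One \<oplus> s) ;; q \<approx> (?s \<oplus> One) ;; NA v"
      using one NA by (intro eq_derivable.cong_Seq)
    also have "\<dots> \<approx> ?s ;; NA v"
      using T Alt v by (intro Alt_One_Seq_NA) simp_all
    also have "\<dots> \<approx> s ;; q"
      using comm eq_derivable.sym[OF NA] by (intro eq_derivable.cong_Seq)
    also note w(2)
    finally show ?thesis
      by (rule has_hnf_cong) (rule has_hnf_prefix_sum[OF w(1)])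
  next
    case 2
    also have "One \<oplus> v \<approx> v \<oplus> One"
      using v by (intro Alt_commute[of _ _ One]) simp_all
    finally have q': "q \<approx> v \<oplus> One" .
    have "(One \<oplus> s) ;; q \<approx> (?s \<oplus> One) ;; (v \<oplus> One)"
      using one q' by (intro eq_derivable.cong_Seq)
    also have "\<dots> \<approx> ?s ;; (v \<oplus> One) \<oplus> One"
      using T Alt v by (intro Alt_One_Seq_Alt_One) simp_all
    also have "\<dots> \<approx> One \<oplus> ?s ;; (v \<oplus> One)"
      using T Alt v by (intro Alt_commute[of _ _ One]) simp_all
    \<comment> \<open>After A13 has extracted \<open>One\<close>, the rewriting of \<open>s\<close>
      and \<open>q\<close> is undone so that \<open>w\<close> applies.\<close>
    also have "\<dots> \<approx> One \<oplus> s ;; q"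
      using comm eq_derivable.sym[OF q'] by (intro cong_intros) simp_all
    also have "\<dots> \<approx> One \<oplus> w"
      using w by (intro cong_intros) simp_all
    finally show ?thesis
      by (rule has_hnf_cong) (rule has_hnf_One_Alt_prefix_sum[OF w(1)])
  qed
qed

lemma has_hnf_Seq:
  assumes "has_hnf p" and q: "q \<in> pexprs L P" "has_hnf q"
  shows "has_hnf (p ;; q)"
proof -
  obtain u where u: "u \<in> prefix_sums L P" and "p \<approx> u \<or> p \<approx> One \<oplus> u"
    using assms unfolding has_hnf_def by blast
  then have "p ;; q \<approx> u ;; q \<or> p ;; q \<approx> (One \<oplus> u) ;; q"
    using eq_derivable.cong_Seq[OF _ eq_derivable.refl[OF pexprs_imp_pterms[OF q(1)]]] by blast
  moreover have "has_hnf (u ;; q)"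
    using prefix_sums_Seq[OF u q(1)] unfolding has_hnf_def by blast
  ultimately show ?thesis
    using has_hnf_One_Alt_prefix_sum_Seq[OF u q] has_hnf_cong by blast
qed

section \<open>From guarded expressions to all expressions\<close>

lemmas has_hnf_intros = has_hnf_prefix_sum[OF prefix_sums.Zero] has_hnf_One has_hnf_Pre
  has_hnf_Alt has_hnf_Seq has_hnf_NA pexprs_imp_pterms

text \<open>Guardedness excludes identifiers at the head, and those below a prefix are never
  inspected, since \<open>has_hnf_Pre\<close> needs no induction hypothesis.\<close>

lemma guarded_has_hnf: "p \<in> pexprs L P \<Longrightarrow> guarded_term p \<Longrightarrow> has_hnf p"
  by (induction rule: pexprs.induct) (auto intro: has_hnf_intros)

text \<open>The structural induction is repeated, now with identifiers. One unfolding suffices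
  there, because the guarded right-hand side is covered by the preceding lemma; no well-founded
  order on identifiers is involved.\<close>

lemma pexprs_has_hnf:
  assumes "p \<in> pexprs L P" "rec_spec L P \<Delta>" "guarded P \<Delta>" "spec_equations P \<Delta> \<subseteq> E"
  shows "has_hnf p"
  using assms(1)
proof induction
  case (7 X)
  have "Ident X \<approx> \<Delta> X"
    using 7 assms(4) by (auto simp: spec_equations_def intro: eq_derivable.ax)
  moreover have "has_hnf (\<Delta> X)"
    using 7 assms by (auto simp: rec_spec_def guarded_def intro: guarded_has_hnf)
  ultimately show ?case by (rule has_hnf_cong)
qed (auto intro: has_hnf_intros)

end

theorem theorem5p2:
  fixes Act :: "'a set" and \<tau> :: 'a and P :: "'x set" and \<Delta> :: "'x \<Rightarrow> ('a, 'x) pterm"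
    and p :: "('a, 'x) pterm"
  assumes "\<tau> \<notin> Act"
    and "finite P"
    and "rec_spec (Act \<union> {\<tau>}) P \<Delta>"
    and "guarded P \<Delta>"
    and "p \<in> pexprs (Act \<union> {\<tau>}) P"
  shows "\<exists>(n::nat) (a :: nat \<Rightarrow> 'a) (q :: nat \<Rightarrow> ('a, 'x) pterm).
    (\<forall>i\<in>{1..n}. a i \<in> Act \<union> {\<tau>} \<and> q i \<in> pexprs (Act \<union> {\<tau>}) P) \<and>
    (eq_derivable (Act \<union> {\<tau>}) P (tsp_axioms (Act \<union> {\<tau>}) \<union> spec_equations P \<Delta>)
       p (psum (\<lambda>i. a i \<cdot> q i) n) \<or>
     eq_derivable (Act \<union> {\<tau>}) P (tsp_axioms (Act \<union> {\<tau>}) \<union> spec_equations P \<Delta>)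
       p (One \<oplus> psum (\<lambda>i. a i \<cdot> q i) n))"
proof -
  interpret tsp_theory "Act \<union> {\<tau>}" P "tsp_axioms (Act \<union> {\<tau>}) \<union> spec_equations P \<Delta>"
    by unfold_locales blast
  have "has_hnf p"
    using assms by (intro pexprs_has_hnf) auto
  then show ?thesis
    unfolding has_hnf_def using prefix_sums_imp_psum by blast
qed

end
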